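(* Let $X$ be a finite set with $|X|=n\ge 2$, let $\tau$ be the discrete topology on $X$, and let $G_\tau$ be the discrete topological graph of $X$. Then the domination number of $G_\tau$ is $$\gamma(G_\tau)=\begin{cases}1, & \text{if } n=2,\\ n, & \text{if } n>2.\end{cases}$$
   Context: For a non-empty set $X$ with the discrete topology $\tau$ (so $\tau$ is the family of all subsets of $X$), the discrete topological graph $G_\tau=(V,E)$ is the simple undirected graph with vertex set $V=\{A\in\tau : A\neq\emptyset,\ A\neq X\}$ in which two vertices $A,B$ are adjacent if and only if $A\cap B=\emptyset$. A dominating set of a graph is a set $D$ of vertices such that every vertex not in $D$ is adjacent to some vertex of $D$; the domination number $\gamma$ is the minimum cardinality of a dominating set. *)

theory Defs
  imports "HOL-Analysis.Abstract_Topology" "Graph_Theory.Pair_Digraph"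
begin

text \<open>
  As in Graph_Theory, an undirected edge is modelled by a pair of opposite arcs, so a finite
  simple graph is a \<open>pair_graph\<close> (finite, loop-free, symmetric, without parallel arcs).
\<close>

definition discrete_topological_graph :: "'a set \<Rightarrow> 'a set pair_pre_digraph" where
  "discrete_topological_graph X =
     (let V = {A. openin (discrete_topology X) A \<and> A \<noteq> {} \<and> A \<noteq> X}
      in \<lparr> pverts = V, parcs = {(A, B). A \<in> V \<and> B \<in> V \<and> A \<inter> B = {}} \<rparr>)"

lemma pair_graph_discrete_topological_graph:
  assumes "finite X"
  shows "pair_graph (discrete_topological_graph X)"
proof -
  define V where "V = {A. openin (discrete_topology X) A \<and> A \<noteq> {} \<and> A \<noteq> X}"
  have V: "finite V"
    by (rule finite_subset[of _ "Pow X"]) (use assms in \<open>auto simp: V_def\<close>)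
  have arcs: "finite {(A, B). A \<in> V \<and> B \<in> V \<and> A \<inter> B = {}}"
    by (rule finite_subset[of _ "V \<times> V"]) (use V in auto)
  have "{} \<notin> V"
    by (simp add: V_def)
  then show ?thesis
    unfolding discrete_topological_graph_def V_def[symmetric] Let_def
    using V arcs
    by unfold_locales (auto simp: symmetric_def sym_def)
qed

definition dominating_set :: "('a, 'b) pre_digraph \<Rightarrow> 'a set \<Rightarrow> bool" where
  "dominating_set G D \<longleftrightarrow>
     D \<subseteq> verts G \<and> (\<forall>v \<in> verts G - D. \<exists>d \<in> D. d \<rightarrow>\<^bsub>G\<^esub> v)"

text \<open>
  Infinite dominating sets are excluded because \<open>card\<close> maps them to 0. The value is
  unspecified if there is no finite dominating set.
\<close>

definition domination_number :: "('a, 'b) pre_digraph \<Rightarrow> nat" where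
  "domination_number G = (LEAST k. \<exists>D. dominating_set G D \<and> finite D \<and> card D = k)"

end

theory Submission
  imports Defs
begin

text \<open>
  The bounds come from the two extreme kinds of vertices, the singletons and their complements.
  A proper subset misses some point \<open>x\<close> and is then adjacent to \<open>{x}\<close>, so the
  \<open>n\<close> singletons dominate. Conversely the only neighbour of \<open>X - {x}\<close> is \<open>{x}\<close>,
  so a dominating set contains one of these two vertices for each point \<open>x\<close>
  (\<open>dominating_set_contains_singleton_or_complement\<close>). If \<open>n > 2\<close>, these choices
  differ for different \<open>x\<close>, because the complement of a point is then not a singleton, and a
  dominating set has at least \<open>n\<close> elements. If \<open>n = 2\<close>, the two vertices are
  complements of each other, and either of them dominates.
\<close>

lemma domination_number_eqI:
  assumes "dominating_set G D" and "finite D" and "card D = k"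
    and "\<And>D'. dominating_set G D' \<Longrightarrow> finite D' \<Longrightarrow> k \<le> card D'"
  shows "domination_number G = k"
  unfolding domination_number_def by (rule Least_equality) (use assms in auto)

lemma dominating_set_discrete_topological_graph_iff:
  "dominating_set (with_proj (discrete_topological_graph X)) D \<longleftrightarrow>
     D \<subseteq> {A. A \<subseteq> X \<and> A \<noteq> {} \<and> A \<noteq> X} \<and>
     (\<forall>A. A \<subseteq> X \<and> A \<noteq> {} \<and> A \<noteq> X \<and> A \<notin> D \<longrightarrow> (\<exists>B\<in>D. B \<inter> A = {}))"
proof -
  let ?G = "with_proj (discrete_topological_graph X)" and ?V = "{A. A \<subseteq> X \<and> A \<noteq> {} \<and> A \<noteq> X}"
  have V: "verts ?G = ?V"
    by (simp add: discrete_topological_graph_def Let_def)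
  have arc: "B \<rightarrow>\<^bsub>?G\<^esub> A \<longleftrightarrow> B \<in> ?V \<and> A \<in> ?V \<and> B \<inter> A = {}" for A B
    by (simp add: discrete_topological_graph_def Let_def arcs_ends_def arc_to_ends_def)
  have "(\<exists>B\<in>D. B \<rightarrow>\<^bsub>?G\<^esub> A) \<longleftrightarrow> (\<exists>B\<in>D. B \<inter> A = {})" if "D \<subseteq> ?V" "A \<in> ?V" for A
    unfolding arc using that by (meson subsetD)
  then show ?thesis
    unfolding dominating_set_def V by (simp add: Ball_def cong: conj_cong)
qed

text \<open>
  A nonempty subset of \<open>X\<close> that is disjoint from \<open>X - {x}\<close> can only be \<open>{x}\<close>, so
  no other vertex can dominate \<open>X - {x}\<close>.
\<close>

lemma dominating_set_contains_singleton_or_complement: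
  assumes D: "dominating_set (with_proj (discrete_topological_graph X)) D"
    and x: "x \<in> X" and "X \<noteq> {x}"
  shows "{x} \<in> D \<or> X - {x} \<in> D"
proof (cases "X - {x} \<in> D")
  case False
  have "X - {x} \<noteq> {}" "X - {x} \<noteq> X"
    using x \<open>X \<noteq> {x}\<close> by auto
  then obtain B where B: "B \<in> D" "B \<inter> (X - {x}) = {}"
    using D False unfolding dominating_set_discrete_topological_graph_iff
    by (metis Diff_subset)
  moreover have "B \<subseteq> X" "B \<noteq> {}"
    using D B(1) unfolding dominating_set_discrete_topological_graph_iff by auto
  ultimately have "B = {x}" by blast
  with B(1) show ?thesis by simp
qed simp

lemma dominating_set_singletons:
  assumes "\<And>x. X \<noteq> {x}"
  shows "dominating_set (with_proj (discrete_topological_graph X)) ((\<lambda>x. {x}) ` X)"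
  unfolding dominating_set_discrete_topological_graph_iff
proof (intro conjI allI impI)
  show "(\<lambda>x. {x}) ` X \<subseteq> {A. A \<subseteq> X \<and> A \<noteq> {} \<and> A \<noteq> X}"
    using assms by blast
next
  fix A assume "A \<subseteq> X \<and> A \<noteq> {} \<and> A \<noteq> X \<and> A \<notin> (\<lambda>x. {x}) ` X"
  then obtain x where "x \<in> X" "x \<notin> A" by blast
  then show "\<exists>B\<in>(\<lambda>x. {x}) ` X. B \<inter> A = {}" by blast
qed

text \<open>
  Choosing for each point its singleton or its complement inside \<open>D\<close> injects \<open>X\<close> into
  \<open>D\<close>: a singleton and a complement of a point have different cardinalities when \<open>X\<close> has
  more than two points.
\<close>

lemma card_le_card_dominating_set:
  assumes D: "dominating_set (with_proj (discrete_topological_graph X)) D" "finite D"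
    and X: "finite X" "card X > 2"
  shows "card X \<le> card D"
proof -
  have "X \<noteq> {x}" for x
    using X by auto
  then have "\<forall>x\<in>X. \<exists>A\<in>D. A = {x} \<or> A = X - {x}"
    using dominating_set_contains_singleton_or_complement[OF D(1)] by blast
  then obtain f where f: "\<And>x. x \<in> X \<Longrightarrow> f x \<in> D" "\<And>x. x \<in> X \<Longrightarrow> f x = {x} \<or> f x = X - {x}"
    by metis
  have complement_not_singleton: "X - {x} \<noteq> {y}" if "x \<in> X" for x y
  proof
    assume "X - {x} = {y}"
    then have "card (X - {x}) = 1" by simp
    then show False using X that by simp
  qed
  have "inj_on f X"
  proof (rule inj_onI)
    fix x y assume "x \<in> X" "y \<in> X" "f x = f y"
    then show "x = y"
      using f(2)[of x] f(2)[of y] complement_not_singleton[of x y] complement_not_singleton[of y x]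
      by (metis Diff_iff singleton_iff)
  qed
  then show ?thesis
    using f(1) D(2) by (intro card_inj_on_le[of f]) auto
qed

text \<open>
  Here the injection above breaks down, since \<open>{a}\<close> is both a singleton and the complement of
  \<open>b\<close>: one vertex serves both points.
\<close>

lemma domination_number_two_points:
  assumes "a \<noteq> b"
  shows "domination_number (with_proj (discrete_topological_graph {a, b})) = 1"
proof (rule domination_number_eqI)
  show "dominating_set (with_proj (discrete_topological_graph {a, b})) {{a}}"
    using assms unfolding dominating_set_discrete_topological_graph_iff by auto
next
  fix D assume "dominating_set (with_proj (discrete_topological_graph {a, b})) D" "finite D"
  moreover from this have "D \<noteq> {}"
    using dominating_set_contains_singleton_or_complement[of "{a, b}" D a] assms by auto
  ultimately show "1 \<le> card D"
    by (simp add: Suc_le_eq card_gt_0_iff)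
qed auto

theorem theorem2p5:
  fixes X :: "'a set" and n :: nat
  assumes "finite X" and "card X = n" and "n \<ge> 2"
  shows "domination_number (with_proj (discrete_topological_graph X)) = (if n = 2 then 1 else n)"
proof (cases "n = 2")
  case True
  then obtain a b where "X = {a, b}" "a \<noteq> b"
    using assms by (auto simp: card_2_iff)
  then show ?thesis
    using True domination_number_two_points by simp
next
  case False
  have "domination_number (with_proj (discrete_topological_graph X)) = n"
  proof (rule domination_number_eqI)
    show "dominating_set (with_proj (discrete_topological_graph X)) ((\<lambda>x. {x}) ` X)"
      using assms by (intro dominating_set_singletons) auto
    show "card ((\<lambda>x. {x}) ` X) = n"
      using assms by (simp add: card_image)
  next
    fix D assume "dominating_set (with_proj (discrete_topological_graph X)) D" "finite D"
    then show "n \<le> card D"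
      using card_le_card_dominating_set[of X D] assms False by simp
  qed (use assms in auto)
  then show ?thesis
    using False by simp
qed

end
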